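(* Let $a,b,c$ be integers with $2\le a<b<c$ and $\gcd(a,b,c)=1$, put $S=\{a,b,c\}$, and suppose that $S$ is covered, i.e. either $c=a+b$, or $c\ne a+b$ and $\rho=c\bmod(a+b)$ belongs to $\Theta_{a+b}\cup\Theta_{c+a}\cup\Theta_{c+b}$. For $i\in\{0,1,2,3\}$ let $\mathcal W_i=\{x\in\mathbb N:\mathcal G_S(x)=i\}$. Let $V=\mathbb N\setminus(\mathcal W_0\cup\mathcal W_1)$; for $v\in V$ let $$L(v)=\min\{t\in\mathbb N: v-at\notin V\}-1$$ (with the convention $y\notin V$ for $y<0$), and let $V_2=\{v\in V:L(v)\text{ even}\}$, $V_3=\{v\in V:L(v)\text{ odd}\}$. Then $$\mathcal W_1=\mathcal W_0+a,\qquad \mathcal W_2=V_2,\qquad \mathcal W_3=V_3 .$$ (Equivalently, $\mathcal W_0$ together with the function $L$ determines all of $\mathcal G_S$.)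
   Context: $\mathbb N=\{0,1,2,\dots\}$. For a finite nonempty set $S$ of positive integers, the subtraction game $S$ has positions $x\in\mathbb N$ and legal moves $x\mapsto x-s$ for $s\in S$, $s\le x$. The nim-value is $\mathcal G_S(x)=\operatorname{mex}\{\mathcal G_S(x-s):s\in S,\ s\le x\}$, where mex is the least non-negative integer not in the set; for $|S|=3$ the values lie in $\{0,1,2,3\}$. $\mathcal W_0(S)=\{x:\mathcal G_S(x)=0\}$. For $X\subseteq\mathbb N$, $X+a=\{x+a:x\in X\}$. Integer intervals: $[u,v]=\{u,\dots,v\}$, $[u,v)=\{u,\dots,v-1\}$ (empty if there are no such integers). Given $a<b$, write $B=\{a,b\}$, $\delta=b-a=\eta a+\varepsilon$ with $\eta=\lfloor\delta/a\rfloor$, $0\le\varepsilon<a$, and put $\mathcal Z=\mathcal W_0(B)\cap[0,a+b)$, $D=[a,b)\setminus\mathcal Z$, and $$\Lambda=\begin{cases}[(\eta+1)a,\ (\eta+1)a+\varepsilon),&\eta\text{ even},\\ [\eta a+\varepsilon,\ (\eta+1)a),&\eta\text{ odd}.\end{cases}$$ These sets are viewed as subsets of $\mathbb Z/(a+b)\mathbb Z$, and residues are identified with $[0,a+b)$. The admissible sets $\Theta_{a+b},\Theta_{c+a},\Theta_{c+b}\subseteq\mathbb Z/(a+b)\mathbb Z$ (they depend only on $a,b$; the subscripts are labels) are defined, with translates read modulo $a+b$, by: $\rho\in\Theta_{a+b}\iff\mathcal Z\cap(\mathcal Z+\rho)=\varnothing$; $\rho\in\Theta_{c+a}\iff\mathcal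 Z\cap[0,\delta)\cap(\mathcal Z+(\delta-\rho))=\varnothing$; $\rho\in\Theta_{c+b}\iff(\rho+\Lambda)\cap\mathcal Z=\varnothing$ and $(\rho+D)\cap\Lambda=\varnothing$. *)

theory Defs
  imports Main
begin

definition mex :: "nat set \<Rightarrow> nat" where
  "mex A = (LEAST n. n \<notin> A)"

text \<open>The guard \<open>0 < s\<close> only serves termination; it is vacuous for a set of positive integers.\<close>

function nim_value :: "nat set \<Rightarrow> nat \<Rightarrow> nat" where
  "nim_value S x = mex ((\<lambda>s. nim_value S (x - s)) ` {s \<in> S. 0 < s \<and> s \<le> x})"
  by pat_completeness auto
termination
  by (relation "measure snd") auto

declare nim_value.simps [simp del]

definition nim_level :: "nat set \<Rightarrow> nat \<Rightarrow> nat set" where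
  "nim_level S i = {x. nim_value S x = i}"

text \<open>Subsets of \<open>\<int>/m\<int>\<close> are represented by their residues in \<open>{0..<m}\<close>. The translation
  amount is an integer, since it may be negative.\<close>

definition translate_mod :: "nat \<Rightarrow> nat set \<Rightarrow> int \<Rightarrow> nat set" where
  "translate_mod m X r = (\<lambda>x. nat ((int x + r) mod int m)) ` X"

text \<open>In the following definitions \<open>a < b\<close> is assumed, so that \<open>b - a\<close> is the true difference;
  \<open>(b - a) div a\<close> and \<open>(b - a) mod a\<close> are the quotient \<open>\<eta>\<close> and the remainder \<open>\<epsilon>\<close>.\<close>

definition zero_residues :: "nat \<Rightarrow> nat \<Rightarrow> nat set" where
  "zero_residues a b = nim_level {a, b} 0 \<inter> {0..<a + b}"

definition D_set :: "nat \<Rightarrow> nat \<Rightarrow> nat set" where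
  "D_set a b = {a..<b} - zero_residues a b"

definition Lambda_set :: "nat \<Rightarrow> nat \<Rightarrow> nat set" where
  "Lambda_set a b =
    (let \<eta> = (b - a) div a; \<epsilon> = (b - a) mod a
     in if even \<eta> then {(\<eta> + 1) * a..<(\<eta> + 1) * a + \<epsilon>}
        else {\<eta> * a + \<epsilon>..<(\<eta> + 1) * a})"

definition Theta_ab :: "nat \<Rightarrow> nat \<Rightarrow> nat set" where
  "Theta_ab a b = {\<rho> \<in> {0..<a + b}.
     zero_residues a b \<inter> translate_mod (a + b) (zero_residues a b) (int \<rho>) = {}}"

definition Theta_ca :: "nat \<Rightarrow> nat \<Rightarrow> nat set" where
  "Theta_ca a b = {\<rho> \<in> {0..<a + b}.
     zero_residues a b \<inter> {0..<b - a} \<inter>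
       translate_mod (a + b) (zero_residues a b) (int (b - a) - int \<rho>) = {}}"

definition Theta_cb :: "nat \<Rightarrow> nat \<Rightarrow> nat set" where
  "Theta_cb a b = {\<rho> \<in> {0..<a + b}.
     translate_mod (a + b) (Lambda_set a b) (int \<rho>) \<inter> zero_residues a b = {} \<and>
     translate_mod (a + b) (D_set a b) (int \<rho>) \<inter> Lambda_set a b = {}}"

definition covered :: "nat \<Rightarrow> nat \<Rightarrow> nat \<Rightarrow> bool" where
  "covered a b c \<longleftrightarrow>
     c = a + b \<or>
     (c \<noteq> a + b \<and> c mod (a + b) \<in> Theta_ab a b \<union> Theta_ca a b \<union> Theta_cb a b)"

text \<open>The integers \<open>v - a t\<close> are compared with the image of \<open>V\<close> in the integers, so negative
  numbers count as lying outside \<open>V\<close>. For \<open>v \<in> V\<close> the least such \<open>t\<close> is positive, so the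
  subtraction of 1 is not truncated.\<close>

definition run_length :: "nat \<Rightarrow> nat set \<Rightarrow> nat \<Rightarrow> nat" where
  "run_length a V v = (LEAST t. int v - int a * int t \<notin> int ` V) - 1"

end

theory Submission
  imports Defs
begin

text \<open>Ferguson's pairing property gives \<open>W\<^sub>1 = W\<^sub>0 + a\<close> for every subtraction set with least
  element \<open>a\<close>. Since the values alternate between 2 and 3 along a run of \<open>V\<close> with step \<open>a\<close>, it remains
  to see that each run starts with the value 2, i.e. that a position \<open>v\<close> of value 3 is never preceded
  by a position \<open>v - a\<close> of value 1. In such a configuration \<open>v - 2a\<close> has value 0, and \<open>v - b\<close>,
  \<open>v - c\<close> have the values 0 and 2 in some order.

  The kernel of a game containing the moves \<open>p\<close> and \<open>r\<close> has period \<open>p + r\<close> as soon as, for every other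
  move \<open>s\<close>, no \<open>x < s\<close> in the kernel has \<open>x + p + r - s\<close> in the kernel. Each of the three
  admissible sets yields a period in this way (\<open>a + b\<close>, \<open>c + a\<close>, \<open>c + b\<close>), and the period together with
  the agreement of the games \<open>{a, b}\<close> and \<open>{a, b, c}\<close> below \<open>c\<close> excludes the configuration. For
  \<open>c = a + b\<close> no period is needed: with \<open>x = v - a - b\<close>, the configuration at \<open>x\<close> reproduces itself at
  \<open>x - 2a\<close>, an infinite descent.

  Positions are taken in the integers, negative ones being given the value \<open>-1\<close>.\<close>

section \<open>Kernels of subtraction games on the integers\<close>

text \<open>The independent and absorbing set of the move graph. Negative positions are kept
  outside, so illegal moves need no side condition \<open>s \<le> x\<close>.\<close>

definition kernel :: "int set \<Rightarrow> (int \<Rightarrow> bool) \<Rightarrow> bool" where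
  "kernel S Z \<longleftrightarrow> (\<forall>x. Z x \<longleftrightarrow> 0 \<le> x \<and> (\<forall>s\<in>S. \<not> Z (x - s)))"

lemma kernel_nonneg: "kernel S Z \<Longrightarrow> Z x \<Longrightarrow> 0 \<le> x"
  unfolding kernel_def by blast

lemma kernel_indep: "kernel S Z \<Longrightarrow> Z x \<Longrightarrow> s \<in> S \<Longrightarrow> \<not> Z (x - s)"
  unfolding kernel_def by blast

lemma kernel_absorb: "kernel S Z \<Longrightarrow> 0 \<le> x \<Longrightarrow> \<not> Z x \<Longrightarrow> \<exists>s\<in>S. Z (x - s)"
  unfolding kernel_def by blast

lemma kernel_small:
  assumes "kernel S Z" "\<forall>s\<in>S. x < s" "0 \<le> x"
  shows "Z x"
  using kernel_absorb[OF assms(1,3)] kernel_nonneg[OF assms(1)] assms(2) by fastforce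

text \<open>Strong induction. If \<open>Z x\<close>, the moves \<open>p\<close> and \<open>r\<close>
  lead from \<open>x + (p + r)\<close> to positions one move above \<open>x\<close>, hence outside
  \<open>Z\<close>. For any other move \<open>s\<close>, the case \<open>s \<le> x\<close> is
  shifted down by a period, and \<open>base\<close> covers \<open>x < s\<close>. Conversely, a move
  from \<open>x\<close> into \<open>Z\<close> is shifted up by a period.\<close>

lemma kernel_period:
  assumes K: "kernel S Z" and pos: "\<forall>s\<in>S. 0 < s" and p: "p \<in> S" and r: "r \<in> S"
    and base: "\<And>s x. s \<in> S \<Longrightarrow> s \<noteq> p \<Longrightarrow> s \<noteq> r \<Longrightarrow> x < s \<Longrightarrow> Z x \<Longrightarrow> \<not> Z (x + (p + r) - s)"
  shows "0 \<le> x \<Longrightarrow> Z (x + (p + r)) \<longleftrightarrow> Z x"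
proof (induction "nat x" arbitrary: x rule: less_induct)
  case less
  have IH: "Z (y + (p + r)) \<longleftrightarrow> Z y" if "0 \<le> y" "y < x" for y
    using less.hyps[of y] that by simp
  have nn: "0 \<le> x + (p + r)" using less.prems bspec[OF pos p] bspec[OF pos r] by simp
  show ?case
  proof
    assume Zx: "Z x"
    show "Z (x + (p + r))"
    proof (rule ccontr)
      assume "\<not> Z (x + (p + r))"
      then obtain s where s: "s \<in> S" "Z (x + (p + r) - s)"
        using kernel_absorb[OF K nn] by blast
      have "s \<noteq> p" using s(2) kernel_indep[OF K _ r, of "x + r"] Zx by (auto simp: algebra_simps)
      moreover have "s \<noteq> r" using s(2) kernel_indep[OF K _ p, of "x + p"] Zx by (auto simp: algebra_simps)
      ultimately have "\<not> x < s" using base[OF s(1)] Zx s(2) by blast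
      then have "Z (x - s)" using IH[of "x - s"] s(2) bspec[OF pos s(1)] by (simp add: algebra_simps)
      then show False using kernel_indep[OF K Zx s(1)] by blast
    qed
  next
    assume Zq: "Z (x + (p + r))"
    show "Z x"
    proof (rule ccontr)
      assume "\<not> Z x"
      then obtain s where s: "s \<in> S" "Z (x - s)" using kernel_absorb[OF K less.prems] by blast
      have "Z (x - s + (p + r))"
        using IH[of "x - s"] s bspec[OF pos s(1)] kernel_nonneg[OF K s(2)] by simp
      then show False using kernel_indep[OF K Zq s(1)] by (simp add: algebra_simps)
    qed
  qed
qed

lemma period_iterate:
  assumes q: "0 < q" and per: "\<And>x. 0 \<le> x \<Longrightarrow> Z (x + q) \<longleftrightarrow> Z x" and "0 \<le> (x::int)"
  shows "Z x \<longleftrightarrow> Z (x mod q)"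
  using \<open>0 \<le> x\<close>
proof (induction "nat x" arbitrary: x rule: less_induct)
  case less
  show ?case
  proof (cases "x < q")
    case True
    then show ?thesis using less.prems by simp
  next
    case False
    then have "Z (x - q) \<longleftrightarrow> Z ((x - q) mod q)" using less q by simp
    then show ?thesis using per[of "x - q"] False by simp
  qed
qed

text \<open>Where the kernels agree on all smaller positions, the move \<open>c\<close> could change
  the status of a position only by joining two elements of \<open>Z\<close>. The bound
  \<open>y \<le> x\<close> in \<open>free\<close> allows both a global use and one restricted to
  positions below \<open>c\<close>.\<close>

lemma kernel_agree:
  assumes K: "kernel S Z" and K': "kernel (insert c S) Z'"
    and pos: "\<forall>s\<in>insert c S. 0 < s"
    and free: "\<And>y. y \<le> x \<Longrightarrow> Z y \<Longrightarrow> \<not> Z (y - c)"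
  shows "Z' x \<longleftrightarrow> Z x"
  using free
proof (induction "nat x" arbitrary: x rule: less_induct)
  case less
  show ?case
  proof (cases "0 \<le> x")
    case True
    have eq: "Z' (x - s) \<longleftrightarrow> Z (x - s)" if "s \<in> insert c S" for s
    proof (cases "s \<le> x")
      case True
      show ?thesis
        using less.hyps[of "x - s"] less.prems bspec[OF pos that] True by simp
    next
      case False
      then show ?thesis
        using kernel_nonneg[OF K, of "x - s"] kernel_nonneg[OF K', of "x - s"] by linarith
    qed
    have "Z' x \<longleftrightarrow> (\<forall>s\<in>insert c S. \<not> Z' (x - s))"
      using K' True unfolding kernel_def by blast
    also have "\<dots> \<longleftrightarrow> \<not> Z (x - c) \<and> (\<forall>s\<in>S. \<not> Z (x - s))"
      using eq by blast
    also have "\<dots> \<longleftrightarrow> \<not> Z (x - c) \<and> Z x"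
      using K True unfolding kernel_def by blast
    finally show ?thesis using less.prems[of x] by blast
  next
    case False
    then show ?thesis using kernel_nonneg[OF K] kernel_nonneg[OF K'] by blast
  qed
qed

lemma kernel_agree_below:
  assumes K: "kernel S Z" and K': "kernel (insert c S) Z'"
    and pos: "\<forall>s\<in>insert c S. 0 < s" and "x < c"
  shows "Z' x \<longleftrightarrow> Z x"
proof (rule kernel_agree[OF K K' pos])
  fix y assume "y \<le> x"
  then show "\<not> Z (y - c)" using kernel_nonneg[OF K, of "y - c"] \<open>x < c\<close> by linarith
qed

section \<open>Three-element games\<close>

text \<open>The two halves of the mex rule. As \<open>f\<close> is negative exactly on negative
  positions, an illegal move satisfies \<open>f_move\<close> trivially and is never a witness in
  \<open>f_mex\<close>.\<close>

locale three_move_game =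
  fixes a b c :: int and f :: "int \<Rightarrow> int"
  assumes a_pos: "0 < a" and ab: "a < b" and bc: "b < c"
    and f_neg: "f x < 0 \<longleftrightarrow> x < 0"
    and f_move: "0 \<le> x \<Longrightarrow> s \<in> {a, b, c} \<Longrightarrow> f (x - s) \<noteq> f x"
    and f_mex: "0 \<le> j \<Longrightarrow> j < f x \<Longrightarrow> \<exists>s\<in>{a, b, c}. f (x - s) = j"
begin

abbreviation "Z x \<equiv> f x = 0"

lemma Z_nonneg: "Z x \<Longrightarrow> 0 \<le> x"
  using f_neg[of x] by linarith

lemma kernel_Z: "kernel {a, b, c} Z"
  unfolding kernel_def
proof (intro allI iffI)
  fix x assume "Z x"
  then show "0 \<le> x \<and> (\<forall>s\<in>{a, b, c}. f (x - s) \<noteq> 0)"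
    using Z_nonneg f_move by metis
next
  fix x assume x: "0 \<le> x \<and> (\<forall>s\<in>{a, b, c}. f (x - s) \<noteq> 0)"
  then have "\<not> 0 < f x" using f_mex[of 0 x] by auto
  then show "Z x" using x f_neg[of x] by linarith
qed

lemma Z_diff:
  assumes "Z x" "Z y"
  shows "x - y \<noteq> a" "x - y \<noteq> b" "x - y \<noteq> c"
  using kernel_indep[OF kernel_Z assms(1), of "x - y"] assms(2) by auto

lemma Z_move: "0 \<le> x \<Longrightarrow> \<not> Z x \<Longrightarrow> Z (x - a) \<or> Z (x - b) \<or> Z (x - c)"
  using kernel_absorb[OF kernel_Z, of x] by auto

lemma Z_small: "0 \<le> x \<Longrightarrow> x < a \<Longrightarrow> Z x"
  using kernel_small[OF kernel_Z, of x] ab bc by auto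

text \<open>By induction, a move \<open>t\<close> from \<open>x - a\<close> into \<open>Z\<close>
  yields the value 1 at \<open>x - t\<close>, and a move \<open>s\<close> from \<open>x\<close> to
  the value 1 yields \<open>Z (x - a - s)\<close>. Either way a position would share its value, 1 or
  0, with one of its options.\<close>

lemma ferguson_pairing: "f x = 1 \<longleftrightarrow> Z (x - a)"
proof (induction "nat x" arbitrary: x rule: less_induct)
  case less
  have IH: "f y = 1 \<longleftrightarrow> Z (y - a)" if "0 \<le> y" "y < x" for y
    using less.hyps[of y] that by simp
  show ?case
  proof
    assume one: "f x = 1"
    have x: "0 \<le> x" using f_neg[of x] one by linarith
    obtain s where s: "s \<in> {a, b, c}" "Z (x - s)" using f_mex[of 0 x] one by auto
    \<comment> \<open>Minimality of \<open>a\<close> enters here: if any move is legal at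
      \<open>x\<close>, then so is \<open>a\<close>.\<close>
    have xa: "0 \<le> x - a" using Z_nonneg[OF s(2)] s(1) ab bc by auto
    show "Z (x - a)"
    proof (rule ccontr)
      assume "\<not> Z (x - a)"
      then obtain t where t: "t \<in> {a, b, c}" "Z (x - a - t)"
        using Z_move[OF xa] by blast
      then have "0 \<le> x - t" "x - t < x" using Z_nonneg[OF t(2)] a_pos ab bc by auto
      then have "f (x - t) = 1" using IH[of "x - t"] t(2) by (simp add: algebra_simps)
      then show False using f_move[OF x t(1)] one by simp
    qed
  next
    assume zero: "Z (x - a)"
    have x: "0 \<le> x" using Z_nonneg[OF zero] a_pos by simp
    have "\<not> 1 < f x"
    proof
      assume "1 < f x"
      then obtain s where s: "s \<in> {a, b, c}" "f (x - s) = 1" using f_mex[of 1 x] by auto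
      have "0 \<le> x - s" using f_neg[of "x - s"] s(2) by linarith
      moreover have "x - s < x" using s(1) a_pos ab bc by auto
      ultimately have "Z (x - s - a)" using IH s(2) by blast
      then have "Z (x - a - s)" by (simp add: algebra_simps)
      then show False using kernel_indep[OF kernel_Z zero s(1)] by blast
    qed
    moreover have "f x \<noteq> 0" using f_move[OF x, of a] zero by simp
    moreover have "0 \<le> f x" using f_neg[of x] x by linarith
    ultimately show "f x = 1" by linarith
  qed
qed

lemma f_le: "f x \<le> 3"
proof (rule ccontr)
  assume "\<not> f x \<le> 3"
  then have "{0, 1, 2, 3} \<subseteq> {f (x - a), f (x - b), f (x - c)}"
    using f_mex[of 0 x] f_mex[of 1 x] f_mex[of 2 x] f_mex[of 3 x] by auto
  then have "card {0, 1, 2, 3 :: int} \<le> card {f (x - a), f (x - b), f (x - c)}"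
    by (intro card_mono) auto
  also have "\<dots> \<le> 3" by (simp add: card_insert_if)
  finally show False by simp
qed

text \<open>Through the pairing, membership in \<open>V\<close> becomes a condition on
  \<open>Z\<close> alone, so that periods of \<open>Z\<close> carry over to
  \<open>V\<close>.\<close>

lemma ge2_iff: "2 \<le> f x \<longleftrightarrow> 0 \<le> x \<and> \<not> Z x \<and> \<not> Z (x - a)"
  using f_neg[of x] ferguson_pairing[of x] by linarith

lemma ge2_large: "2 \<le> f x \<Longrightarrow> 2 * a \<le> x"
  using Z_small[of x] Z_small[of "x - a"] ge2_iff[of x] by linarith

text \<open>The induction hypothesis of \<open>three_preceded_by_two\<close>: below
  \<open>v\<close>, no run of \<open>V\<close> with step \<open>a\<close> begins with the value
  3.\<close>

definition starts_two :: "int \<Rightarrow> bool" where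
  "starts_two v \<longleftrightarrow> (\<forall>y<v. f y = 3 \<longrightarrow> f (y - a) = 2)"

lemma start_value:
  assumes "starts_two v" "x < v" "2 \<le> f x" "f (x - a) = 1"
  shows "f x = 2"
  using assms f_le[of x] unfolding starts_two_def by force

text \<open>The only two ways in which a position \<open>v\<close> of value 3 can follow a position
  \<open>v - a\<close> of value 1.\<close>

definition bad_b :: "int \<Rightarrow> bool" where
  "bad_b v \<longleftrightarrow> 2 \<le> f v \<and> Z (v - 2 * a) \<and> Z (v - b) \<and> f (v - c) = 2"

definition bad_c :: "int \<Rightarrow> bool" where
  "bad_c v \<longleftrightarrow> 2 \<le> f v \<and> Z (v - 2 * a) \<and> Z (v - c) \<and> f (v - b) = 2"

text \<open>The options of a position of value 3 have the values 0, 1, 2 in some order. The pairing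
  excludes 0 at \<open>v - a\<close>, and 1 at \<open>v - a\<close> leaves only
  \<open>bad_b v\<close> and \<open>bad_c v\<close>.\<close>

lemma three_preceded_by_two:
  assumes nb: "\<And>v. starts_two v \<Longrightarrow> \<not> bad_b v" and nc: "\<And>v. starts_two v \<Longrightarrow> \<not> bad_c v"
  shows "f v = 3 \<Longrightarrow> f (v - a) = 2"
proof (induction "nat v" arbitrary: v rule: less_induct)
  case less
  have v: "0 \<le> v" using f_neg[of v] less.prems by linarith
  have "starts_two v"
    unfolding starts_two_def
  proof (intro allI impI)
    fix y assume y: "y < v" "f y = 3"
    have "0 \<le> y" using f_neg[of y] y(2) by linarith
    then show "f (y - a) = 2" using less.hyps[of y] y by simp
  qed
  then have no: "\<not> bad_b v" "\<not> bad_c v" using nb nc by auto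
  have na: "f (v - a) \<noteq> 0" using ferguson_pairing[of v] less.prems by simp
  have "f (v - a) \<noteq> 1"
  proof
    assume one: "f (v - a) = 1"
    then have "Z (v - 2 * a)" using ferguson_pairing[of "v - a"] by (simp add: algebra_simps)
    moreover have "Z (v - b) \<and> f (v - c) = 2 \<or> Z (v - c) \<and> f (v - b) = 2"
      using f_mex[of 0 v] f_mex[of 2 v] one less.prems by auto
    ultimately show False using no less.prems unfolding bad_b_def bad_c_def by auto
  qed
  moreover have "f (v - a) = 0 \<or> f (v - a) = 1 \<or> f (v - a) = 2"
    using f_mex[of 0 v] f_mex[of 1 v] f_mex[of 2 v] less.prems by auto
  ultimately show ?case using na by blast
qed

section \<open>The case of the sum\<close>

text \<open>Infinite descent: \<open>x - a\<close> turns out to have value 3, hence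
  \<open>x - 2 * a\<close> has value 2, and the remaining conditions recur there. For the initial
  \<open>x = v - a - b\<close>, the position \<open>x + b - a\<close> is
  \<open>v - 2 * a\<close>.\<close>

lemma sum_descent:
  assumes c: "c = a + b" and st: "starts_two v"
  shows "x < v \<Longrightarrow> f x = 2 \<Longrightarrow> \<not> Z (x - a) \<Longrightarrow> Z (x - a - b) \<Longrightarrow> Z (x + b - a) \<Longrightarrow> False"
proof (induction "nat x" arbitrary: x rule: less_induct)
  case less
  note prems = less.prems
  have x: "a + b \<le> x" using Z_nonneg[OF prems(4)] by linarith
  have n2: "\<not> Z (x - 2 * a)" using Z_diff(3)[OF prems(5), of "x - 2 * a"] c by auto
  have xa: "2 \<le> f (x - a)" "f (x - a) \<noteq> 2"
    using ge2_iff[of "x - a"] n2 prems(3) x ab a_pos f_move[of x a] prems(2) by auto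
  have "Z (x - 2 * a - a) \<or> Z (x - 2 * a - b) \<or> Z (x - 2 * a - c)"
    using Z_move[OF _ n2] x ab by linarith
  moreover have "\<not> Z (x - 2 * a - b)"
    using Z_diff(1)[OF prems(4), of "x - 2 * a - b"] by auto
  \<comment> \<open>Otherwise \<open>x - 2 * a\<close> would have value 1, and \<open>x - a\<close>
    would begin a run with a value other than 2.\<close>
  moreover have "\<not> Z (x - 2 * a - a)"
  proof
    assume "Z (x - 2 * a - a)"
    then have "f (x - a - a) = 1" using ferguson_pairing[of "x - 2 * a"] by (simp add: algebra_simps)
    then show False using start_value[OF st, of "x - a"] prems(1) xa a_pos by simp
  qed
  ultimately have Z3: "Z (x - 2 * a - a - b)" and n3: "\<not> Z (x - 2 * a - a)"
    using c by (auto simp: algebra_simps)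
  have f3: "f (x - a) = 3" using xa f_le[of "x - a"] by linarith
  have "x - a < v" using prems(1) a_pos by simp
  then have "f (x - a - a) = 2" using st f3 unfolding starts_two_def by (metis (full_types))
  then have f2: "f (x - 2 * a) = 2" by (simp add: algebra_simps)
  \<comment> \<open>This position lies \<open>a\<close> below an element of \<open>Z\<close>. Its
    options by \<open>b\<close> and \<open>c\<close> are \<open>x - 2 * a\<close> and
    \<open>x - 3 * a\<close>, both outside \<open>Z\<close>, so the option by \<open>a\<close> must
    lie in \<open>Z\<close>.\<close>
  have "\<not> Z (x + b - 2 * a)" using Z_diff(1)[OF prems(5), of "x + b - 2 * a"] by auto
  moreover have "0 \<le> x + b - 2 * a" using x ab a_pos by linarith
  ultimately have "Z (x + b - 2 * a - a) \<or> Z (x + b - 2 * a - b) \<or> Z (x + b - 2 * a - c)"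
    using Z_move by blast
  moreover have "x + b - 2 * a - b = x - 2 * a" "x + b - 2 * a - c = x - 2 * a - a"
    using c by simp_all
  ultimately have "Z (x + b - 2 * a - a)" using n2 n3 by metis
  then have up: "Z (x - 2 * a + b - a)" by (simp add: algebra_simps)
  show False
    using less.hyps[OF _ _ f2 n3 Z3 up] prems(1) x ab a_pos by simp
qed

text \<open>For \<open>bad_b\<close>, the descent starts at \<open>v - c\<close>. For
  \<open>bad_c\<close>, \<open>v - c\<close> is \<open>v - b - a\<close>, so the pairing gives
  \<open>v - b\<close> the value 1 instead of 2.\<close>

lemma no_bad_sum:
  assumes c: "c = a + b" and st: "starts_two v"
  shows "\<not> bad_b v" "\<not> bad_c v"
proof -
  show "\<not> bad_b v"
  proof
    assume bad: "bad_b v"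
    define x where "x = v - a - b"
    have fx: "f x = 2" and up: "Z (x + b - a)" and xa: "Z (x + a)"
      using bad c unfolding bad_b_def x_def by (simp_all add: algebra_simps)
    have na: "\<not> Z (x - a)" using ferguson_pairing[of x] fx by simp
    have "\<not> Z (x - b)" using Z_diff(3)[OF xa, of "x - b"] c by auto
    then have "Z (x - a - b)"
      using f_mex[of 0 x] fx na c by (auto simp: algebra_simps)
    moreover have "x < v" unfolding x_def using a_pos ab by simp
    ultimately show False using sum_descent[OF c st] fx na up by blast
  qed
  show "\<not> bad_c v"
  proof
    assume bad: "bad_c v"
    then have "f (v - b) = 1"
      using ferguson_pairing[of "v - b"] c unfolding bad_c_def by (simp add: algebra_simps)
    then show False using bad unfolding bad_c_def by simp
  qed
qed

section \<open>Reduction to the two-element game\<close>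

context
  fixes zB :: "int \<Rightarrow> bool"
  assumes kB: "kernel {a, b} zB"
begin

lemma zB_diff: "zB x \<Longrightarrow> zB y \<Longrightarrow> x - y \<noteq> a" "zB x \<Longrightarrow> zB y \<Longrightarrow> x - y \<noteq> b"
  using kernel_indep[OF kB, of x "x - y"] by auto

lemma zB_move: "0 \<le> x \<Longrightarrow> \<not> zB x \<Longrightarrow> zB (x - a) \<or> zB (x - b)"
  using kernel_absorb[OF kB, of x] by auto

text \<open>With only the moves \<open>a\<close> and \<open>b\<close>, the base condition of
  \<open>kernel_period\<close> is vacuous.\<close>

lemma zB_period: "0 \<le> x \<Longrightarrow> zB (x + (a + b)) \<longleftrightarrow> zB x"
  using kernel_period[OF kB, of a b x] a_pos ab by auto

lemma Z_eq_zB: "x < c \<Longrightarrow> Z x \<longleftrightarrow> zB x"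
  using kernel_agree_below[OF kB, of c Z x] kernel_Z a_pos ab bc
  by (auto simp: insert_commute)

text \<open>The other option \<open>x - a - b\<close> of \<open>x - a\<close> lies one period below
  \<open>x\<close>, hence outside \<open>zB\<close>.\<close>

lemma zB_gap:
  assumes "\<not> zB x" "\<not> zB (x - a)" "a \<le> x"
  shows "zB (x - 2 * a)"
  using zB_move[of "x - a"] zB_period[of "x - a - b"] kernel_nonneg[OF kB, of "x - a - b"] assms
  by (auto simp: algebra_simps)

text \<open>The last conclusion is \<open>zB (x - 2 * a)\<close> shifted by \<open>a + b\<close>. It
  speaks of \<open>zB\<close> because \<open>x + b - a\<close> may exceed \<open>c\<close>.\<close>

lemma Z_gap:
  assumes "0 \<le> x" "x < c" "\<not> Z x" "\<not> Z (x - a)"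
  shows "2 * a \<le> x" "Z (x - 2 * a)" "zB (x + b - a)"
proof -
  show 1: "2 * a \<le> x" using Z_small[of x] Z_small[of "x - a"] assms by linarith
  have z: "zB (x - 2 * a)"
    using zB_gap[of x] Z_eq_zB[of x] Z_eq_zB[of "x - a"] assms 1 a_pos by auto
  then show "Z (x - 2 * a)" using Z_eq_zB[of "x - 2 * a"] assms a_pos by auto
  show "zB (x + b - a)" using zB_period[of "x - 2 * a"] z 1 by (simp add: algebra_simps)
qed

text \<open>Now \<open>zB_gap\<close> holds for \<open>Z\<close>. Applied at \<open>v - c\<close>,
  it puts \<open>v - c - 2 * a\<close> into \<open>Z\<close>, at distance \<open>c\<close> from
  \<open>v - 2 * a\<close>. Applied at \<open>v - b\<close>, with the period \<open>a + b\<close>,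
  it gives \<open>Z (v - a)\<close>, against \<open>2 \<le> f v\<close>.\<close>

lemma no_bad_same:
  assumes same: "\<And>x. Z x \<longleftrightarrow> zB x"
  shows "\<not> bad_b v" "\<not> bad_c v"
proof -
  have gap: "zB (x - 2 * a) \<and> 2 * a \<le> x" if "2 \<le> f x" for x
    using zB_gap[of x] ge2_iff[of x] ge2_large[of x] that same a_pos by auto
  show "\<not> bad_b v"
  proof
    assume bad: "bad_b v"
    then have "Z (v - c - 2 * a)" using gap[of "v - c"] same unfolding bad_b_def by simp
    then show False using Z_diff(3)[of "v - 2 * a" "v - c - 2 * a"] bad unfolding bad_b_def by simp
  qed
  show "\<not> bad_c v"
  proof
    assume bad: "bad_c v"
    then have "zB (v - b - 2 * a + (a + b))"
      using gap[of "v - b"] zB_period[of "v - b - 2 * a"] unfolding bad_c_def by simp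
    then have "Z (v - a)" using same by (simp add: algebra_simps)
    then show False using bad ge2_iff[of v] unfolding bad_c_def by simp
  qed
qed

lemma Z_periodic_mod:
  assumes "0 < q" "\<And>x. 0 \<le> x \<Longrightarrow> Z (x + q) \<longleftrightarrow> Z x" "0 \<le> v - t"
  shows "Z (v - t) \<longleftrightarrow> Z ((v mod q - t) mod q)"
  using period_iterate[of q Z "v - t"] assms by (simp add: mod_diff_left_eq)

section \<open>The period c + a\<close>

text \<open>Only \<open>s = b\<close> has to be checked. If \<open>y < b - a\<close>, then
  \<open>free\<close> applies because both positions are below \<open>c\<close>. Otherwise
  \<open>y + a - b\<close> lies in \<open>[0, a)\<close>, hence in \<open>Z\<close>, exactly
  \<open>c\<close> below the position in question.\<close>

lemma Z_period_ca:
  assumes free: "\<And>x. 0 \<le> x \<Longrightarrow> x < b - a \<Longrightarrow> zB x \<Longrightarrow> \<not> zB (x + c - (b - a))"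
    and "0 \<le> x"
  shows "Z (x + (c + a)) \<longleftrightarrow> Z x"
proof (rule kernel_period[OF kernel_Z])
  fix s y assume s: "s \<in> {a, b, c}" "s \<noteq> c" "s \<noteq> a" and y: "y < s" "Z y"
  have sb: "s = b" using s by auto
  have y0: "0 \<le> y" using Z_nonneg[OF y(2)] .
  show "\<not> Z (y + (c + a) - s)"
  proof (cases "y < b - a")
    case True
    then show ?thesis
      using free[OF y0 True] Z_eq_zB[of y] Z_eq_zB[of "y + c - (b - a)"] y bc a_pos
      unfolding sb by (simp add: algebra_simps)
  next
    case False
    then have "Z (y + a - b)" using Z_small[of "y + a - b"] y unfolding sb by simp
    then show ?thesis
      using Z_diff(3)[of "y + (c + a) - s" "y + a - b"] unfolding sb by auto
  qed
qed (use a_pos ab bc \<open>0 \<le> x\<close> in auto)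

text \<open>For \<open>bad_b\<close>, the period turns the data at \<open>v\<close> into data near
  \<open>x = v - c\<close>, where \<open>x - a\<close> begins a run with the value 2 that
  \<open>x\<close> has too. For \<open>bad_c\<close>, \<open>v\<close> is reduced modulo the period
  and the residue is compared with \<open>zB\<close>.\<close>

lemma no_bad_ca:
  assumes per: "\<And>x. 0 \<le> x \<Longrightarrow> Z (x + (c + a)) \<longleftrightarrow> Z x" and st: "starts_two v"
  shows "\<not> bad_b v" "\<not> bad_c v"
proof -
  show "\<not> bad_b v"
  proof
    assume bad: "bad_b v"
    define x where "x = v - c"
    have fx: "f x = 2" using bad unfolding bad_b_def x_def by simp
    have x2: "2 * a \<le> x" using ge2_large[of x] fx by simp
    have nv: "\<not> Z v" "\<not> Z (v - a)" using bad ge2_iff[of v] unfolding bad_b_def by auto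
    \<comment> \<open>Since \<open>v = x + c\<close>, the position \<open>v\<close> is
      \<open>x - a\<close> shifted by the period \<open>c + a\<close>.\<close>
    have n1: "\<not> Z (x - a)" using per[of "x - a"] nv(1) x2 a_pos unfolding x_def by simp
    have n2: "\<not> Z (x - 2 * a)" using per[of "x - 2 * a"] nv(2) x2 unfolding x_def by (simp add: algebra_simps)
    have x3: "3 * a \<le> x" using Z_small[of "x - 2 * a"] n2 x2 by linarith
    have "Z (x - 3 * a + (c + a))"
      using bad unfolding bad_b_def x_def by (simp add: algebra_simps)
    then have "Z (x - 3 * a)" using per[of "x - 3 * a"] x3 by simp
    then have "f (x - a - a) = 1" using ferguson_pairing[of "x - a - a"] by (simp add: algebra_simps)
    moreover have "2 \<le> f (x - a)"
      using ge2_iff[of "x - a"] n1 n2 x2 a_pos by (simp add: algebra_simps)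
    moreover have "x - a < v" unfolding x_def using a_pos ab bc by simp
    ultimately have "f (x - a) = 2" using start_value[OF st, of "x - a"] by simp
    then show False using f_move[of x a] fx x2 a_pos by simp
  qed
  show "\<not> bad_c v"
  proof
    assume bad: "bad_c v"
    define q y where "q = c + a" and "y = v mod q"
    have q: "0 < q" unfolding q_def using a_pos ab bc by simp
    have y: "0 \<le> y" "y < q" unfolding y_def using q by auto
    have vb: "2 * a \<le> v - b" using ge2_large[of "v - b"] bad unfolding bad_c_def by simp
    have tr: "Z (v - t) \<longleftrightarrow> Z (y - t)" if "t \<le> v" "t \<le> y" "0 \<le> t" for t
      using Z_periodic_mod[of q v t] per q that y unfolding q_def y_def by simp
    have n: "\<not> Z v" "\<not> Z (v - a)" "\<not> Z (v - b)" "\<not> Z (v - b - a)"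
      using bad ge2_iff[of v] ge2_iff[of "v - b"] unfolding bad_c_def by auto
    have m0: "\<not> Z y" using tr[of 0] n(1) y vb a_pos ab by simp
    have m1: "\<not> Z (y - a)"
      using tr[of a] n(2) vb a_pos ab Z_nonneg[of "y - a"] by linarith
    have m2: "\<not> Z (y - b)" if "b \<le> y"
      using tr[of b] n(3) vb a_pos ab that by linarith
    have m3: "\<not> Z (y - (b + a))" if "b + a \<le> y"
      using tr[of "b + a"] n(4) vb a_pos ab that by (simp add: algebra_simps)
    show False
    proof (cases "y < c")
      case True
      \<comment> \<open>All three options of \<open>y\<close> would lie outside \<open>Z\<close>, as
        \<open>y - c\<close> is negative.\<close>
      then show False
        using Z_move[OF y(1) m0] m1 m2 Z_nonneg[of "y - b"] Z_nonneg[of "y - c"] by linarith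
    next
      case False
      then have "0 \<le> y - b" "y - b < c" "\<not> Z (y - b)" "\<not> Z (y - b - a)"
        using m2 m3 y bc ab Z_nonneg[of "y - b - a"] unfolding q_def
        by (auto simp: algebra_simps)
      from Z_gap(3)[OF this] have "zB (y - a)" by (simp add: algebra_simps)
      then show False using m1 Z_eq_zB[of "y - a"] y unfolding q_def by simp
    qed
  qed
qed

section \<open>The period c + b\<close>

text \<open>The two conditions defining \<open>Theta_cb\<close>, carried over from residues to
  integer positions.\<close>

context
  assumes c1: "\<And>d. b - a \<le> d \<Longrightarrow> d < b \<Longrightarrow> \<not> zB d \<Longrightarrow> \<not> zB (c + d)"
    and c2: "\<And>d. 0 \<le> d \<Longrightarrow> d < b \<Longrightarrow> \<not> zB d \<Longrightarrow> \<not> zB (c + d) \<Longrightarrow> zB (c + d + a)"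
begin

text \<open>Only \<open>s = a\<close> has to be checked, that is, \<open>c + d\<close> must lie
  outside \<open>Z\<close>. If \<open>zB d\<close>, it is \<open>c\<close> above an element of
  \<open>Z\<close>. Otherwise \<open>c1\<close> and \<open>c2\<close> give
  \<open>zB (c + d + a)\<close>, and one period \<open>a + b\<close> lower \<open>c + d - b\<close>
  lies in \<open>Z\<close>.\<close>

lemma Z_period_cb:
  assumes "0 \<le> x"
  shows "Z (x + (c + b)) \<longleftrightarrow> Z x"
proof (rule kernel_period[OF kernel_Z])
  fix s y assume s: "s \<in> {a, b, c}" "s \<noteq> c" "s \<noteq> b" and y: "y < s" "Z y"
  have sa: "s = a" using s by auto
  define d where "d = y + b - a"
  have d: "b - a \<le> d" "d < b" using Z_nonneg[OF y(2)] y(1) unfolding d_def sa by auto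
  have "\<not> Z (c + d)"
  proof (cases "zB d")
    case True
    then show ?thesis using Z_eq_zB[of d] Z_diff(3)[of "c + d" d] d bc by auto
  next
    case False
    then have "zB (c + d + a)" using c1 c2 d ab by simp
    then have "zB (c + d - b)" using zB_period[of "c + d - b"] d ab bc by (simp add: algebra_simps)
    then have "Z (c + d - b)" using Z_eq_zB[of "c + d - b"] d by simp
    then show ?thesis using Z_diff(2)[of "c + d" "c + d - b"] by auto
  qed
  then show "\<not> Z (y + (c + b) - s)" unfolding d_def sa by (simp add: algebra_simps)
qed (use a_pos ab bc assms in auto)

text \<open>Below \<open>b\<close> only the move \<open>a\<close> is legal, so membership alternates
  along steps of \<open>a\<close>.\<close>

lemma zB_step_back:
  assumes "zB d" "2 * a \<le> d" "d < b"
  shows "zB (d - 2 * a)"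
  using zB_gap[of "d"] zB_diff(1)[OF assms(1), of "d - a"] zB_move[of "d - a"] assms a_pos
    kernel_nonneg[OF kB, of "d - a - b"] by (auto simp: algebra_simps)

text \<open>Both configurations are reduced modulo \<open>c + b\<close>. Residues below
  \<open>c\<close> are settled by \<open>Z_gap\<close> or by the lack of an option in
  \<open>Z\<close>. For a residue \<open>c + d\<close>, the position \<open>d\<close> lies in
  \<open>zB\<close>, and stepping back from it by \<open>2 * a\<close> gives the conflict unless
  \<open>d\<close> is small.\<close>

lemma no_bad_cb:
  shows "\<not> bad_b v" "\<not> bad_c v"
proof -
  define q where "q = c + b"
  have q: "0 < q" unfolding q_def using a_pos ab bc by simp
  show "\<not> bad_b v"
  proof
    assume bad: "bad_b v"
    define x y where "x = v - c" and "y = x mod q"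
    have y: "0 \<le> y" "y < q" unfolding y_def using q by auto
    have x2: "2 * a \<le> x" using ge2_large[of x] bad unfolding bad_b_def x_def by simp
    have n: "\<not> Z x" "\<not> Z (x - a)" "\<not> Z v" "\<not> Z (v - a)" "Z (v - 2 * a)"
      using bad ge2_iff[of v] ge2_iff[of x] unfolding bad_b_def x_def by auto
    \<comment> \<open>Modulo \<open>q = c + b\<close>, adding \<open>c\<close> amounts to
      subtracting \<open>b\<close>, so positions near \<open>v\<close> are also read off from the
      residue \<open>y\<close> of \<open>x\<close>.\<close>
    have xq: "x - (b + t) + q = v - t" for t unfolding x_def q_def by simp
    have tr: "Z (x - t) \<longleftrightarrow> Z ((y - t) mod q)" if "t \<le> x" for t
      using Z_periodic_mod[of q x t] Z_period_cb q that unfolding q_def y_def by simp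
    have tv: "Z (v - t) \<longleftrightarrow> Z ((y - (b + t)) mod q)" if "t \<le> v" for t
    proof -
      have "(v - t) mod q = (x - (b + t)) mod q" using xq[of t] by (metis mod_add_self2)
      then show ?thesis
        using period_iterate[of q Z "v - t"] Z_period_cb q that
        unfolding q_def y_def by (simp add: mod_diff_left_eq)
    qed
    have v2: "2 * a \<le> v" using x2 bc ab a_pos unfolding x_def by simp
    have m0: "\<not> Z y" using tr[of 0] n(1) y x2 a_pos by simp
    have m1: "\<not> Z (y - a)"
      using tr[of a] n(2) y x2 a_pos Z_nonneg[of "y - a"] by fastforce
    have m2: "\<not> Z (y - b)"
      using tv[of 0] n(3) y v2 a_pos ab Z_nonneg[of "y - b"] by fastforce
    have m3: "\<not> Z (y - b - a)"
      using tv[of a] n(4) y v2 a_pos ab Z_nonneg[of "y - b - a"]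
      by (fastforce simp: algebra_simps)
    have m4: "Z ((y - b - 2 * a) mod q)"
      using tv[of "2 * a"] n(5) v2 by (simp add: algebra_simps)
    have m4': "Z (y - b - 2 * a)" if "b + 2 * a \<le> y"
      using m4 y that a_pos ab by simp
    show False
    proof (cases "y < c")
      case True
      note gap = Z_gap[OF y(1) True m0 m1]
      consider "y < b" | "b \<le> y" "y < b + 2 * a" | "b + 2 * a \<le> y" by linarith
      then show False
      proof cases
        case 1
        \<comment> \<open>The left side is negative here. Its residue is
          \<open>c + (y - 2 * a)\<close>, which lies \<open>c\<close> above the element
          \<open>y - 2 * a\<close> of \<open>Z\<close>.\<close>
        have "y - b - 2 * a = c + (y - 2 * a) - q" unfolding q_def by simp
        then have "(y - b - 2 * a) mod q = (c + (y - 2 * a)) mod q"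
          by (metis minus_mod_self2)
        also have "\<dots> = c + (y - 2 * a)" using 1 gap(1) a_pos ab bc unfolding q_def by simp
        finally show False using m4 Z_diff(3)[OF _ gap(2), of "c + (y - 2 * a)"] by simp
      next
        case 2
        then show False using Z_small[of "y - b"] Z_small[of "y - b - a"] m2 m3 by linarith
      next
        case 3
        then have "zB (y - b - 2 * a)"
          using m4' Z_eq_zB[of "y - b - 2 * a"] True a_pos ab by simp
        then have "zB (y - a)" using zB_period[of "y - b - 2 * a"] 3 by (simp add: algebra_simps)
        then show False using m1 Z_eq_zB[of "y - a"] True a_pos by simp
      qed
    next
      case False
      define d where "d = y - c"
      have d: "0 \<le> d" "d < b" "y = c + d" using False y unfolding d_def q_def by auto
      have yb: "0 \<le> y - b" "y - b < c" using False y bc unfolding q_def by auto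
      note gap = Z_gap[OF yb m2 m3]
      have z1: "zB (y - a)" using gap(3) by (simp add: algebra_simps)
      have nz: "\<not> zB y" using zB_diff(1)[OF _ z1, of y] by auto
      \<comment> \<open>\<open>y + a\<close> is \<open>y - b\<close> shifted by
        \<open>a + b\<close>. With \<open>nz\<close> this refutes the conclusion of
        \<open>c2\<close>, which forces \<open>zB d\<close>.\<close>
      have "\<not> zB (y + a)"
        using zB_period[of "y - b"] Z_eq_zB[of "y - b"] yb m2 by (simp add: algebra_simps)
      then have zd: "zB d" using c2[OF d(1,2)] nz d(3) by auto
      have da: "a \<le> d"
        using z1 m1 Z_eq_zB[of "y - a"] d(3) by linarith
      have "\<not> Z (d - a)"
        using zB_diff(1)[OF zd, of "d - a"] Z_eq_zB[of "d - a"] d bc a_pos by auto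
      then have "\<not> Z (y - a - c)" by (simp add: d(3) algebra_simps)
      moreover have "\<not> Z (y - a - b)" using m3 by (simp add: algebra_simps)
      \<comment> \<open>The last option of \<open>y - a\<close>: once it is excluded,
        \<open>y - a\<close> is outside \<open>Z\<close> without an option in
        \<open>Z\<close>.\<close>
      moreover have "\<not> Z (y - a - a)"
      proof (cases "d < 2 * a")
        case True
        then show ?thesis
          using zB_diff(1)[OF z1, of "y - a - a"] Z_eq_zB[of "y - a - a"] d(3) by auto
      next
        case False
        then have "Z (d - 2 * a)"
          using zB_step_back[OF zd] d Z_eq_zB[of "d - 2 * a"] bc a_pos by auto
        then show ?thesis using Z_diff(3)[of "y - a - a" "d - 2 * a"] d(3) by auto
      qed
      ultimately show False using Z_move[OF _ m1] gap(1) ab a_pos by linarith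
    qed
  qed
  show "\<not> bad_c v"
  proof
    assume bad: "bad_c v"
    define y where "y = v mod q"
    have y: "0 \<le> y" "y < q" unfolding y_def using q by auto
    have vb: "2 * a \<le> v - b" using ge2_large[of "v - b"] bad unfolding bad_c_def by simp
    have vc: "c \<le> v" using bad Z_nonneg[of "v - c"] unfolding bad_c_def by simp
    have tr: "Z (v - t) \<longleftrightarrow> Z (y - t)" if "t \<le> v" "t \<le> y" "0 \<le> t" for t
      using Z_periodic_mod[of q v t] Z_period_cb q that y unfolding q_def y_def by simp
    have n: "\<not> Z v" "\<not> Z (v - a)" "\<not> Z (v - b)" "\<not> Z (v - b - a)" "Z (v - 2 * a)" "Z (v - c)"
      using bad ge2_iff[of v] ge2_iff[of "v - b"] unfolding bad_c_def by auto
    have m0: "\<not> Z y" using tr[of 0] n(1) y vb a_pos ab by simp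
    have m1: "\<not> Z (y - a)"
      using tr[of a] n(2) vb a_pos ab Z_nonneg[of "y - a"] by linarith
    have m2: "\<not> Z (y - b)"
      using tr[of b] n(3) vb a_pos ab Z_nonneg[of "y - b"] by linarith
    have m3: "\<not> Z (y - b - a)"
      using tr[of "b + a"] n(4) vb a_pos ab Z_nonneg[of "y - b - a"] by (auto simp: algebra_simps)
    show False
    proof (cases "y < c")
      case True
      then show False
        using Z_move[OF y(1) m0] m1 m2 Z_nonneg[of "y - c"] by linarith
    next
      case False
      define d where "d = y - c"
      have d: "0 \<le> d" "d < b" "y = c + d" using False y unfolding d_def q_def by auto
      have yb: "0 \<le> y - b" "y - b < c" using False y bc unfolding q_def by auto
      note gap = Z_gap[OF yb m2 m3]
      have z1: "zB (y - a)" using gap(3) by (simp add: algebra_simps)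
      have y2: "2 * a \<le> y" using gap(1) a_pos ab by simp
      have "Z d" using tr[of c] n(6) vc d a_pos ab bc by simp
      then have zd: "zB d" using Z_eq_zB[of d] d bc by simp
      have Z2: "Z (y - 2 * a)" using tr[of "2 * a"] n(5) vb y2 a_pos ab by simp
      \<comment> \<open>The bounds decide whether \<open>y - a\<close> and \<open>y - 2 * a\<close>
        lie below \<open>c\<close>, where \<open>Z\<close> and \<open>zB\<close> agree.\<close>
      consider "d < a" | "a \<le> d" "d < 2 * a" | "2 * a \<le> d" by linarith
      then show False
      proof cases
        case 1
        then show False using z1 m1 Z_eq_zB[of "y - a"] d(3) by simp
      next
        case 2
        then have "zB (y - 2 * a)" using Z2 Z_eq_zB[of "y - 2 * a"] d(3) by simp
        then show False using zB_diff(1)[OF z1, of "y - 2 * a"] by simp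
      next
        case 3
        then have "Z (d - 2 * a)"
          using zB_step_back[OF zd] d Z_eq_zB[of "d - 2 * a"] bc a_pos by auto
        then show False using Z_diff(3)[OF Z2, of "d - 2 * a"] d(3) by simp
      qed
    qed
  qed
qed

end

end

end

section \<open>Nim-values\<close>

lemma mex_notin: "finite A \<Longrightarrow> mex A \<notin> A"
  unfolding mex_def by (rule LeastI_ex) (meson ex_new_if_finite infinite_UNIV_nat)

lemma less_mex: "n < mex A \<Longrightarrow> n \<in> A"
  unfolding mex_def using not_less_Least by blast

definition nim_int :: "nat set \<Rightarrow> int \<Rightarrow> int" where
  "nim_int S x = (if x < 0 then - 1 else int (nim_value S (nat x)))"

lemma nim_int_of_nat [simp]: "nim_int S (int n) = int (nim_value S n)"
  unfolding nim_int_def by simp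

lemma nim_int_neg: "nim_int S x < 0 \<longleftrightarrow> x < 0"
  unfolding nim_int_def by simp

lemma nim_int_move:
  assumes "finite S" "0 \<le> x" "s \<in> S" "0 < s"
  shows "nim_int S (x - int s) \<noteq> nim_int S x"
proof (cases "int s \<le> x")
  case True
  have "nim_value S (nat x) \<notin> (\<lambda>s. nim_value S (nat x - s)) ` {s \<in> S. 0 < s \<and> s \<le> nat x}"
    using assms(1) by (subst nim_value.simps) (intro mex_notin, simp)
  then have "nim_value S (nat x) \<noteq> nim_value S (nat x - s)"
    using assms True by (auto simp: le_nat_iff)
  moreover have "nat (x - int s) = nat x - s" by (simp add: nat_diff_distrib')
  ultimately show ?thesis using assms True unfolding nim_int_def by simp
next
  case False
  then show ?thesis using assms(2) unfolding nim_int_def by simp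
qed

lemma nim_int_mex:
  assumes "0 \<le> j" "j < nim_int S x"
  shows "\<exists>s\<in>S. nim_int S (x - int s) = j"
proof -
  have x: "0 \<le> x" using assms nim_int_neg[of S x] by linarith
  have "nat j < nim_value S (nat x)" using assms x unfolding nim_int_def by simp
  then have "nat j \<in> (\<lambda>s. nim_value S (nat x - s)) ` {s \<in> S. 0 < s \<and> s \<le> nat x}"
    by (subst (asm) nim_value.simps) (rule less_mex)
  then obtain s where s: "s \<in> S" "s \<le> nat x" "nat j = nim_value S (nat x - s)" by auto
  have "nat (x - int s) = nat x - s" by (simp add: nat_diff_distrib')
  then have "nim_int S (x - int s) = j" using s x assms(1) unfolding nim_int_def by auto
  then show ?thesis using s(1) by blast
qed

lemma kernel_nim_int:
  assumes "finite S" "0 \<notin> S"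
  shows "kernel (int ` S) (\<lambda>x. nim_int S x = 0)"
  unfolding kernel_def
proof (intro allI iffI)
  fix x assume z: "nim_int S x = 0"
  then have "0 \<le> x" using nim_int_neg[of S x] by linarith
  moreover have "0 < s" if "s \<in> S" for s using that assms(2) by (cases s) auto
  ultimately show "0 \<le> x \<and> (\<forall>s\<in>int ` S. nim_int S (x - s) \<noteq> 0)"
    using nim_int_move[OF assms(1), of x] z by fastforce
next
  fix x assume x: "0 \<le> x \<and> (\<forall>s\<in>int ` S. nim_int S (x - s) \<noteq> 0)"
  then have "\<not> 0 < nim_int S x" using nim_int_mex[of 0 S x] by auto
  then show "nim_int S x = 0" using x nim_int_neg[of S x] by linarith
qed

lemma three_move_game_nim_int:
  assumes "0 < a" "a < b" "b < c"
  shows "three_move_game (int a) (int b) (int c) (nim_int {a, b, c})"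
proof
  fix x s :: int assume "0 \<le> x" "s \<in> {int a, int b, int c}"
  then show "nim_int {a, b, c} (x - s) \<noteq> nim_int {a, b, c} x"
    using nim_int_move[of "{a, b, c}" x] assms by auto
next
  fix j x assume "0 \<le> j" "j < nim_int {a, b, c} x"
  then show "\<exists>s\<in>{int a, int b, int c}. nim_int {a, b, c} (x - s) = j"
    using nim_int_mex[of j "{a, b, c}" x] by auto
qed (use assms nim_int_neg in auto)

section \<open>The two-element game\<close>

locale two_moves =
  fixes a b :: nat
  assumes a_pos: "0 < a" and ab: "a < b"
begin

definition zB :: "int \<Rightarrow> bool" where
  "zB x \<longleftrightarrow> nim_int {a, b} x = 0"

lemma kernel_zB: "kernel {int a, int b} zB"
  using kernel_nim_int[of "{a, b}"] a_pos ab unfolding zB_def by auto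

text \<open>The bridge from the residue conditions in the admissible sets to integer
  positions.\<close>

lemma zB_mod: "zB (int n) \<longleftrightarrow> n mod (a + b) \<in> zero_residues a b"
proof -
  have "zB (int n) \<longleftrightarrow> zB (int n mod (int a + int b))"
  proof (rule period_iterate)
    fix x :: int assume "0 \<le> x"
    then show "zB (x + (int a + int b)) \<longleftrightarrow> zB x"
      by (intro kernel_period[OF kernel_zB]) (use a_pos ab in auto)
  qed (use a_pos in auto)
  also have "int n mod (int a + int b) = int (n mod (a + b))"
    by (simp add: zmod_int)
  finally show ?thesis
    using a_pos unfolding zB_def zero_residues_def nim_level_def by simp
qed

text \<open>Below \<open>b\<close> only the move \<open>a\<close> is legal, so blocks of length
  \<open>a\<close> lie alternately inside and outside the kernel.\<close>

lemma zB_small: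
  assumes "n < b"
  shows "zB (int n) \<longleftrightarrow> even (n div a)"
  using assms
proof (induction n rule: less_induct)
  case (less n)
  show ?case
  proof (cases "n < a")
    case True
    then show ?thesis using kernel_small[OF kernel_zB, of "int n"] ab by auto
  next
    case False
    have "zB (int n) \<longleftrightarrow> \<not> zB (int n - int a)"
    proof -
      have "\<not> zB (int n - int b)"
        using kernel_nonneg[OF kernel_zB, of "int n - int b"] less.prems by auto
      then show ?thesis
        using kernel_indep[OF kernel_zB, of "int n" "int a"]
          kernel_absorb[OF kernel_zB, of "int n"] by auto
    qed
    also have "int n - int a = int (n - a)" using False by simp
    also have "zB (int (n - a)) \<longleftrightarrow> even ((n - a) div a)"
      using less.IH[of "n - a"] less.prems False a_pos by simp
    also have "n div a = Suc ((n - a) div a)" using False a_pos by (simp add: le_div_geq)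
    ultimately show ?thesis by simp
  qed
qed

text \<open>Since \<open>b = (\<eta> + 1) * a + \<epsilon>\<close>, the window
  \<open>[b - a, b)\<close> meets only the blocks with index \<open>\<eta>\<close> and
  \<open>\<eta> + 1\<close>. Its part in the block of odd index is
  \<open>Lambda_set a b\<close>.\<close>

lemma mem_Lambda:
  assumes "b - a \<le> d" "d < b" "\<not> zB (int d)"
  shows "d \<in> Lambda_set a b"
proof -
  define \<eta> \<epsilon> where "\<eta> = (b - a) div a" and "\<epsilon> = (b - a) mod a"
  have \<epsilon>: "\<epsilon> < a" unfolding \<epsilon>_def using a_pos by simp
  have ba: "b - a = \<eta> * a + \<epsilon>" unfolding \<eta>_def \<epsilon>_def by simp
  have b: "b = (\<eta> + 1) * a + \<epsilon>" using ba ab by simp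
  have odd: "odd (d div a)" using zB_small assms by simp
  show ?thesis
  proof (cases "even \<eta>")
    case True
    have "(\<eta> + 1) * a \<le> d"
    proof (rule ccontr)
      assume "\<not> (\<eta> + 1) * a \<le> d"
      then have "d div a = \<eta>"
        using assms(1) ba by (intro div_nat_eqI) (auto simp: algebra_simps)
      then show False using odd True by simp
    qed
    then show ?thesis using True assms(2) b
      unfolding Lambda_set_def Let_def \<eta>_def \<epsilon>_def by simp
  next
    case False
    have "d < (\<eta> + 1) * a"
    proof (rule ccontr)
      assume "\<not> d < (\<eta> + 1) * a"
      then have "d div a = \<eta> + 1"
        using assms(2) b \<epsilon> by (intro div_nat_eqI) (auto simp: algebra_simps)
      then show False using odd False by simp
    qed
    then show ?thesis using False assms(1) ba
      unfolding Lambda_set_def Let_def \<eta>_def \<epsilon>_def by simp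
  qed
qed

lemma translate_mod_mem:
  assumes "n \<in> X" "int m = (int n + r) mod int q"
  shows "m \<in> translate_mod q X r"
  using assms unfolding translate_mod_def by (auto intro!: image_eqI[of _ _ n])

section \<open>The admissible sets as conditions on integer positions\<close>

lemma Theta_ab_free:
  assumes "c mod (a + b) \<in> Theta_ab a b" "zB x"
  shows "\<not> zB (x - int c)"
proof
  assume y: "zB (x - int c)"
  define m n where "m = nat x" and "n = nat (x - int c)"
  have mn: "x = int m" "x - int c = int n" "m = n + c"
    using kernel_nonneg[OF kernel_zB y] unfolding m_def n_def by auto
  have "int (m mod (a + b)) = (int (n mod (a + b)) + int (c mod (a + b))) mod int (a + b)"
    by (simp only: mn(3) zmod_int of_nat_add mod_add_eq)
  then have "m mod (a + b) \<in>
      translate_mod (a + b) (zero_residues a b) (int (c mod (a + b)))"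
    using y mn zB_mod[of n] by (intro translate_mod_mem[of "n mod (a + b)"]) auto
  then show False using assms mn zB_mod[of m] unfolding Theta_ab_def by auto
qed

text \<open>If \<open>n = x + c - (b - a)\<close> were in \<open>zB\<close>, then \<open>x\<close>
  would be the translate of the residue of \<open>n\<close> by \<open>b - a - c\<close> modulo
  \<open>a + b\<close>, which the admissible set forbids.\<close>

lemma Theta_ca_free:
  assumes "c mod (a + b) \<in> Theta_ca a b" "b < c"
    and x: "0 \<le> x" "x < int b - int a" "zB x"
  shows "\<not> zB (x + int c - (int b - int a))"
proof
  define m n where "m = nat x" and "n = m + c - (b - a)"
  have m: "x = int m" "m < b - a" using x ab unfolding m_def by auto
  have n: "int n = x + int c - (int b - int a)" using m assms(2) ab unfolding n_def by simp
  assume "zB (x + int c - (int b - int a))"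
  then have zn: "n mod (a + b) \<in> zero_residues a b" using n zB_mod[of n] by simp
  have zm: "m \<in> zero_residues a b" using x m zB_mod[of m] ab by simp
  have "(int (n mod (a + b)) + (int (b - a) - int (c mod (a + b)))) mod int (a + b)
      = (int n + (int (b - a) - int c)) mod int (a + b)"
    by (intro mod_add_cong mod_diff_cong refl) (simp_all only: zmod_int mod_mod_trivial)
  also have "int n + (int (b - a) - int c) = int m" using n m ab by simp
  also have "int m mod int (a + b) = int m" using m by simp
  finally have "m \<in> translate_mod (a + b) (zero_residues a b)
      (int (b - a) - int (c mod (a + b)))"
    using zn by (intro translate_mod_mem[of "n mod (a + b)"]) auto
  then show False using assms(1) zm m(2) unfolding Theta_ca_def by auto
qed

lemma Theta_cb_free:
  assumes "c mod (a + b) \<in> Theta_cb a b"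
    and d: "int b - int a \<le> d" "d < int b" "\<not> zB d"
  shows "\<not> zB (int c + d)"
proof
  define m where "m = nat d"
  have m: "d = int m" "b - a \<le> m" "m < b" using d ab unfolding m_def by auto
  assume "zB (int c + d)"
  then have "(c + m) mod (a + b) \<in> zero_residues a b" using zB_mod[of "c + m"] m by simp
  moreover have "(c + m) mod (a + b) \<in>
      translate_mod (a + b) (Lambda_set a b) (int (c mod (a + b)))"
    using mem_Lambda[of m] m d(3)
    by (intro translate_mod_mem[of m]) (simp_all add: zmod_int mod_simps add.commute)
  ultimately show False using assms(1) unfolding Theta_cb_def by auto
qed

text \<open>A \<open>d\<close> outside \<open>zB\<close> is at least \<open>a\<close>, so it lies in
  \<open>D_set a b\<close>, and the residue \<open>r\<close> of \<open>c + d\<close> avoids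
  \<open>Lambda_set a b\<close>. If \<open>r < b\<close>, then even \<open>r < b - a\<close>, and
  adding \<open>a\<close> moves \<open>r\<close> to the next block, inside the kernel. If
  \<open>r \<ge> b\<close>, then \<open>r + a\<close> wraps around to \<open>r - b < a\<close>, in
  the first block.\<close>

lemma Theta_cb_covers:
  assumes "c mod (a + b) \<in> Theta_cb a b"
    and d: "0 \<le> d" "d < int b" "\<not> zB d" "\<not> zB (int c + d)"
  shows "zB (int c + d + int a)"
proof -
  define m r where "m = nat d" and "r = (c + m) mod (a + b)"
  have m: "d = int m" "m < b" using d unfolding m_def by auto
  have "a \<le> m"
  proof (rule ccontr)
    assume "\<not> a \<le> m"
    then show False using zB_small[of m] m d(3) by simp
  qed
  then have "m \<in> D_set a b"
    using m d(3) zB_mod[of m] unfolding D_set_def by simp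
  then have "r \<in> translate_mod (a + b) (D_set a b) (int (c mod (a + b)))"
    unfolding r_def by (intro translate_mod_mem[of m]) (simp_all add: zmod_int mod_simps add.commute)
  then have rL: "r \<notin> Lambda_set a b" using assms(1) unfolding Theta_cb_def by auto
  have r: "r < a + b" unfolding r_def using a_pos by simp
  have rz: "\<not> zB (int r)" using d(4) zB_mod[of "c + m"] zB_mod[of r] r m unfolding r_def by simp
  have "zB (int (r + a))"
  proof (cases "r < b")
    case True
    have "r < b - a" using mem_Lambda[of r] True rz rL by force
    then have "r + a < b" by simp
    moreover have "(r + a) div a = Suc (r div a)" using a_pos by (simp add: div_add_self2)
    ultimately show ?thesis using zB_small[of r] zB_small[of "r + a"] rz by simp
  next
    case False
    have "(r + a) mod (a + b) = r - b" using False r by (simp add: mod_if)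
    moreover have "zB (int (r - b))" using zB_small[of "r - b"] False r ab by simp
    ultimately show ?thesis using zB_mod[of "r + a"] zB_mod[of "r - b"] r False by simp
  qed
  moreover have "(r + a) mod (a + b) = (c + m + a) mod (a + b)"
    unfolding r_def by (simp add: mod_add_left_eq)
  ultimately show ?thesis
    using zB_mod[of "r + a"] zB_mod[of "c + m + a"] m by simp
qed

lemma covered_three_preceded_by_two:
  assumes "b < c" "covered a b c" "nim_int {a, b, c} v = 3"
  shows "nim_int {a, b, c} (v - int a) = 2"
proof -
  interpret three_move_game "int a" "int b" "int c" "nim_int {a, b, c}"
    using three_move_game_nim_int a_pos ab assms(1) by blast
  have "\<not> bad_b u \<and> \<not> bad_c u" if st: "starts_two u" for u
  proof -
    consider "c = a + b" | "c mod (a + b) \<in> Theta_ab a b" | "c mod (a + b) \<in> Theta_ca a b"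
      | "c mod (a + b) \<in> Theta_cb a b"
      using assms(2) unfolding covered_def by blast
    then show ?thesis
    proof cases
      case 1
      then show ?thesis using no_bad_sum[OF _ st] by simp
    next
      case 2
      have "nim_int {a, b, c} x = 0 \<longleftrightarrow> zB x" for x
      proof (rule kernel_agree[OF kernel_zB])
        show "kernel (insert (int c) {int a, int b}) (\<lambda>x. nim_int {a, b, c} x = 0)"
          using kernel_Z by (simp add: insert_commute)
      qed (use Theta_ab_free[OF 2] a_pos ab assms(1) in auto)
      then show ?thesis using no_bad_same[OF kernel_zB] by blast
    next
      case 3
      have "nim_int {a, b, c} (x + (int c + int a)) = 0 \<longleftrightarrow> nim_int {a, b, c} x = 0"
        if "0 \<le> x" for x
        by (rule Z_period_ca[OF kernel_zB Theta_ca_free[OF 3 assms(1)] that])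
      from no_bad_ca[OF kernel_zB this st] show ?thesis by blast
    next
      case 4
      show ?thesis
        using no_bad_cb[OF kernel_zB Theta_cb_free[OF 4] Theta_cb_covers[OF 4]] by blast
    qed
  qed
  then show ?thesis using three_preceded_by_two assms(3) by blast
qed

end

section \<open>Run lengths and the values 2 and 3\<close>

lemma run_length_step:
  assumes "v \<in> V" "a \<le> v" "v - a \<in> V" "0 < a"
  shows "run_length a V v = Suc (run_length a V (v - a))"
proof -
  define P where "P t \<longleftrightarrow> int v - int a * int t \<notin> int ` V" for t
  define Q where "Q t \<longleftrightarrow> int (v - a) - int a * int t \<notin> int ` V" for t
  have PQ: "P (Suc t) \<longleftrightarrow> Q t" for t
    unfolding P_def Q_def using assms(2) by (simp add: algebra_simps)
  have P0: "\<not> P 0" and Q0: "\<not> Q 0" unfolding P_def Q_def using assms(1,3) by simp_all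
  \<comment> \<open>\<open>Suc v\<close> steps lead to a negative integer, which supplies the
    witness that \<open>Least_Suc\<close> requires.\<close>
  have "v < a * Suc v" using assms(4) by (cases a) auto
  then have "int v - int a * int (Suc v) < 0"
    by (metis diff_less_0_iff_less of_nat_less_iff of_nat_mult)
  then have PS: "P (Suc v)" unfolding P_def by auto
  have L: "(LEAST t. P t) = Suc (LEAST t. P (Suc t))" using Least_Suc[OF PS P0] .
  \<comment> \<open>This keeps the truncated subtraction of 1 in \<open>run_length\<close> exact at
    \<open>v - a\<close>.\<close>
  have "(LEAST t. Q t) \<noteq> 0" using PS PQ Q0 LeastI[of Q v] by metis
  moreover have "(LEAST t. P t) = Suc (LEAST t. Q t)" using L unfolding PQ .
  moreover have "run_length a V v = (LEAST t. P t) - 1"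
    and "run_length a V (v - a) = (LEAST t. Q t) - 1"
    unfolding run_length_def P_def Q_def by auto
  ultimately show ?thesis by simp
qed

lemma run_length_start:
  assumes "v \<in> V" "a \<le> v \<Longrightarrow> v - a \<notin> V"
  shows "run_length a V v = 0"
proof -
  have "int v - int a * int 1 \<notin> int ` V"
  proof
    assume "int v - int a * int 1 \<in> int ` V"
    then obtain w where "w \<in> V" "int v - int a = int w" by auto
    then show False using assms(2) by (metis add_diff_cancel_right' diff_add_cancel le_add2 of_nat_add of_nat_eq_iff)
  qed
  then have "(LEAST t. int v - int a * int t \<notin> int ` V) \<le> 1" by (rule Least_le)
  then show ?thesis unfolding run_length_def by simp
qed

theorem theorem42:
  fixes a b c :: nat and S V :: "nat set"
  assumes "2 \<le> a" and "a < b" and "b < c"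
    and "Gcd {a, b, c} = 1"
    and "S = {a, b, c}"
    and "covered a b c"
    and "V = UNIV - (nim_level S 0 \<union> nim_level S 1)"
  shows "nim_level S 1 = (\<lambda>x. x + a) ` nim_level S 0 \<and>
         nim_level S 2 = {v \<in> V. even (run_length a V v)} \<and>
         nim_level S 3 = {v \<in> V. odd (run_length a V v)}"
proof -
  interpret two_moves a b using assms(1,2) by unfold_locales auto
  interpret three_move_game "int a" "int b" "int c" "nim_int S"
    using three_move_game_nim_int assms(1-3,5) by simp
  have shift: "nim_int S (int v - int a) = int (nim_value S (v - a))" if "a \<le> v" for v
    using nim_int_of_nat[of S "v - a"] that by (simp add: of_nat_diff)
  have W1: "nim_level S 1 = (\<lambda>x. x + a) ` nim_level S 0"
  proof (intro equalityI subsetI)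
    fix v assume "v \<in> nim_level S 1"
    then have z: "nim_int S (int v - int a) = 0"
      using ferguson_pairing[of "int v"] unfolding nim_level_def by simp
    then have av: "a \<le> v" using Z_nonneg by fastforce
    then have "v - a \<in> nim_level S 0" using z shift unfolding nim_level_def by simp
    then show "v \<in> (\<lambda>x. x + a) ` nim_level S 0" using av by (intro image_eqI[of _ _ "v - a"]) auto
  next
    fix v assume "v \<in> (\<lambda>x. x + a) ` nim_level S 0"
    then obtain x where "v = x + a" "nim_value S x = 0" unfolding nim_level_def by auto
    then show "v \<in> nim_level S 1" using ferguson_pairing[of "int v"] nim_int_of_nat[of S v] unfolding nim_level_def by simp
  qed
  have V: "v \<in> V \<longleftrightarrow> nim_value S v = 2 \<or> nim_value S v = 3" for v
    using f_le[of "int v"] assms(7) unfolding nim_level_def by auto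
  \<comment> \<open>Inside a run, consecutive values differ and belong to {2, 3}, while the run
    length grows by 1. At the start of a run, the value 3 is excluded because it would require the
    value 2 at \<open>v - a\<close>.\<close>
  have parity: "nim_value S v = (if even (run_length a V v) then 2 else 3)" if "v \<in> V" for v
    using that
  proof (induction v rule: less_induct)
    case (less v)
    have three: "nim_int S (int v - int a) = 2" if "nim_value S v = 3"
      using covered_three_preceded_by_two[of c "int v"] that assms(3,5,6) by simp
    show ?case
    proof (cases "a \<le> v \<and> v - a \<in> V")
      case True
      then have "nim_value S v \<noteq> nim_value S (v - a)"
        using f_move[of "int v" "int a"] shift by simp
      then show ?thesis
        using less.IH[of "v - a"] True run_length_step[of v V a] V[of v] V[of "v - a"]
          less.prems assms(1) by (auto split: if_splits)
    next
      case False
      then have "run_length a V v = 0" using run_length_start less.prems by blast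
      moreover have "nim_value S v \<noteq> 3"
      proof
        assume "nim_value S v = 3"
        then have two: "nim_int S (int v - int a) = 2" using three by simp
        then have "a \<le> v" using f_neg[of "int v - int a"] by linarith
        then show False using two shift V[of "v - a"] False by simp
      qed
      ultimately show ?thesis using V less.prems by auto
    qed
  qed
  have "nim_level S 2 = {v \<in> V. even (run_length a V v)}"
  proof (rule set_eqI)
    fix v show "v \<in> nim_level S 2 \<longleftrightarrow> v \<in> {v \<in> V. even (run_length a V v)}"
      using parity[of v] V[of v] by (cases "even (run_length a V v)") (auto simp: nim_level_def)
  qed
  moreover have "nim_level S 3 = {v \<in> V. odd (run_length a V v)}"
  proof (rule set_eqI)
    fix v show "v \<in> nim_level S 3 \<longleftrightarrow> v \<in> {v \<in> V. odd (run_length a V v)}"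
      using parity[of v] V[of v] by (cases "even (run_length a V v)") (auto simp: nim_level_def)
  qed
  ultimately show ?thesis using W1 by blast
qed

end
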